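(* For a finite Markov decision process with $m$ states: (a) $N^*([0,\Delta_L))\le L+1\le m$; (b) $N(\alpha)=L+1$ for all $\alpha\in(0,\Delta_L)$ if $\{P^t(\phi)s\}_{\phi\in\mathbb{F}_0}$ is a singleton for every $0\le t\le L$.
   Context: A finite Markov decision process (MDP) has a finite state set $\mathbb{X}=\{x^1,\ldots,x^m\}$, a finite nonempty action set $A(x)$ for each $x\in\mathbb{X}$, real one-step rewards $r(x,a)$, transition probabilities $p(\cdot|x,a)$ on $\mathbb{X}$, and a terminal reward $s:\mathbb{X}\to\mathbb{R}$. $\mathbb{F}$ is the set of decision rules (identified with deterministic policies), i.e. maps $\phi$ on $\mathbb{X}$ with $\phi(x)\in A(x)$. Functions on $\mathbb{X}$ are identified with vectors in $\mathbb{R}^m$. $P(\phi)$ is the stochastic matrix with entries $p(x^j|x^i,\phi(x^i))$, $P^t(\phi)$ its $t$-th power, and $r(\phi)(x)=r(x,\phi(x))$. For $\alpha\in[0,1)$: $v_\alpha^\phi=\sum_{t=0}^\infty\alpha^tP^t(\phi)r(\phi)$; $V_\alpha(x)=\max_{\phi\in\mathbb{F}}v_\alpha^\phi(x)$; $T_\alpha^\phi V=r(\phi)+\alpha P(\phi)V$; $V_{0,\alpha}=s$ and $V_{n,\alpha}(x)=\max_{\phi\in\mathbb{F}}T_\alpha^\phi V_{n-1,\alpha}(x)$ for $n\ge1$. $D_n(\alpha)=\{\phi\in\mathbb{F}:V_{n,\alpha}=T_\alpha^\phi V_{n-1,\alpha}\}$ for $n\ge1$, $D(\alpha)=\{\phi\in\mathbb{F}:V_\alpha=v_\alpha^\phi\}$.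 The turnpike integer $N(\alpha)$ is the smallest positive integer such that $D_n(\alpha)\subset D(\alpha)$ for all $n\ge N(\alpha)$ (it is known to exist), and $N^*(E)=\sup_{\alpha\in E}N(\alpha)$. Let $R_1^*=\frac12\{\max_{x,a}r(x,a)-\min_{x,a}r(x,a)\}$ (over $x\in\mathbb{X},a\in A(x)$), $R_2^*=\frac12\{\max_xs(x)-\min_xs(x)\}$, $R^*=\max\{R_1^*,R_2^*\}$. Let $A_{-1}(x)=A(x)$, $r_0(x)=\max_{a\in A(x)}r(x,a)$, $A_0(x)=\operatorname{argmax}_{a\in A(x)}r(x,a)$ and, for $n\ge1$, $r_n(x)=\max_{a\in A_{n-1}(x)}\sum_yp(y|x,a)r_{n-1}(y)$, $A_n(x)=\operatorname{argmax}_{a\in A_{n-1}(x)}\sum_yp(y|x,a)r_{n-1}(y)$. Let $\mathbb{F}_{-1}=\mathbb{F}$ and $\mathbb{F}_n=\{\phi\in\mathbb{F}:\phi(x)\in A_n(x)\ \forall x\in\mathbb{X}\}$; equivalently $\mathbb{F}_n=\{\phi\in\mathbb{F}_{n-1}:P^n(\phi)r(\phi)\ge P^n(\psi)r(\psi)\text{ componentwise for all }\psi\in\mathbb{F}_{n-1}\}$. Let $\mathbb{X}_n=\{x\in\mathbb{X}:A_n(x)\ne A_{n-1}(x)\}$ for $n\ge0$. Let $L=\min\{K\in\{0,1,2,\ldots\}:\mathbb{F}_n=\mathbb{F}_{n+1}\text{ for all }n\ge K\}$. Let $C_{-1}=\infty$ and, for $n\ge0$, $C_n=C_{n-1}$ if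 $\mathbb{X}_n=\emptyset$, and otherwise $C_n=\min\{C_{n-1},\min_{x\in\mathbb{X}_n}(r_n(x)-\max_{a\in A_{n-1}(x)\setminus A_n(x)}g_n(x,a))\}$, where $g_0(x,a)=r(x,a)$ and $g_n(x,a)=\sum_yp(y|x,a)r_{n-1}(y)$ for $n\ge1$. Finally $\Delta_n=\frac{C_n}{2R^*+C_n}$ if $C_n<\infty$ and $\Delta_n=1$ if $C_n=\infty$. *)

theory Defs
  imports "HOL-Analysis.Analysis"
begin

text \<open>
  The state space is a finite type \<open>'x\<close> (so \<open>m = CARD('x)\<close>), and functions on it are
  vectors in \<open>real ^ 'x\<close>. Actions live in an arbitrary type; values of \<open>reward\<close> and
  \<open>trans_prob\<close> at inadmissible actions are never used. \<open>trans_prob M x a y\<close> is \<open>p(y|x,a)\<close>.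
\<close>

record ('x, 'a) mdp =
  actions :: "'x \<Rightarrow> 'a set"
  reward :: "'x \<Rightarrow> 'a \<Rightarrow> real"
  trans_prob :: "'x \<Rightarrow> 'a \<Rightarrow> 'x \<Rightarrow> real"
  terminal :: "'x \<Rightarrow> real"

locale finite_mdp =
  fixes M :: "('x::finite, 'a) mdp"
  assumes finite_actions: "finite (actions M x)"
    and actions_nonempty: "actions M x \<noteq> {}"
    and trans_prob_nonneg: "a \<in> actions M x \<Longrightarrow> 0 \<le> trans_prob M x a y"
    and trans_prob_sum: "a \<in> actions M x \<Longrightarrow> (\<Sum>y\<in>UNIV. trans_prob M x a y) = 1"

definition decision_rules :: "('x::finite, 'a) mdp \<Rightarrow> ('x \<Rightarrow> 'a) set" where
  "decision_rules M = {\<phi>. \<forall>x. \<phi> x \<in> actions M x}"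

definition P_mat :: "('x::finite, 'a) mdp \<Rightarrow> ('x \<Rightarrow> 'a) \<Rightarrow> real ^ 'x ^ 'x" where
  "P_mat M \<phi> = (\<chi> x y. trans_prob M x (\<phi> x) y)"

definition r_vec :: "('x::finite, 'a) mdp \<Rightarrow> ('x \<Rightarrow> 'a) \<Rightarrow> real ^ 'x" where
  "r_vec M \<phi> = (\<chi> x. reward M x (\<phi> x))"

definition s_vec :: "('x::finite, 'a) mdp \<Rightarrow> real ^ 'x" where
  "s_vec M = (\<chi> x. terminal M x)"

text \<open>The instance of \<open>^\<close> at type \<open>real ^ 'x ^ 'x\<close> would not be the matrix power.\<close>

primrec mat_pow :: "real ^ 'x ^ 'x \<Rightarrow> nat \<Rightarrow> real ^ 'x ^ 'x::finite" where
  "mat_pow Q 0 = mat 1"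
| "mat_pow Q (Suc t) = Q ** mat_pow Q t"

definition v_policy :: "('x::finite, 'a) mdp \<Rightarrow> real \<Rightarrow> ('x \<Rightarrow> 'a) \<Rightarrow> real ^ 'x" where
  "v_policy M \<alpha> \<phi> = (\<Sum>t. \<alpha> ^ t *\<^sub>R (mat_pow (P_mat M \<phi>) t *v r_vec M \<phi>))"

definition V_inf :: "('x::finite, 'a) mdp \<Rightarrow> real \<Rightarrow> real ^ 'x" where
  "V_inf M \<alpha> = (\<chi> x. Max ((\<lambda>\<phi>. v_policy M \<alpha> \<phi> $ x) ` decision_rules M))"

definition T_op :: "('x::finite, 'a) mdp \<Rightarrow> real \<Rightarrow> ('x \<Rightarrow> 'a) \<Rightarrow> real ^ 'x \<Rightarrow> real ^ 'x" where
  "T_op M \<alpha> \<phi> V = r_vec M \<phi> + \<alpha> *\<^sub>R (P_mat M \<phi> *v V)"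

primrec V_fin :: "('x::finite, 'a) mdp \<Rightarrow> real \<Rightarrow> nat \<Rightarrow> real ^ 'x" where
  "V_fin M \<alpha> 0 = s_vec M"
| "V_fin M \<alpha> (Suc n) = (\<chi> x. Max ((\<lambda>\<phi>. T_op M \<alpha> \<phi> (V_fin M \<alpha> n) $ x) ` decision_rules M))"

text \<open>Only meaningful for \<open>n \<ge> 1\<close>.\<close>

definition D_fin :: "('x::finite, 'a) mdp \<Rightarrow> nat \<Rightarrow> real \<Rightarrow> ('x \<Rightarrow> 'a) set" where
  "D_fin M n \<alpha> = {\<phi> \<in> decision_rules M. V_fin M \<alpha> n = T_op M \<alpha> \<phi> (V_fin M \<alpha> (n - 1))}"

definition D_inf :: "('x::finite, 'a) mdp \<Rightarrow> real \<Rightarrow> ('x \<Rightarrow> 'a) set" where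
  "D_inf M \<alpha> = {\<phi> \<in> decision_rules M. V_inf M \<alpha> = v_policy M \<alpha> \<phi>}"

text \<open>
  The turnpike integer is \<open>enat\<close>-valued: the infimum of a nonempty set of extended naturals is
  its least element, and \<open>\<infinity>\<close> would signal that no turnpike integer exists. So any finite bound
  on it, or on its supremum, includes the existence claim.
\<close>

definition turnpike :: "('x::finite, 'a) mdp \<Rightarrow> real \<Rightarrow> enat" where
  "turnpike M \<alpha> = Inf {enat N | N. 1 \<le> N \<and> (\<forall>n\<ge>N. D_fin M n \<alpha> \<subseteq> D_inf M \<alpha>)}"

definition turnpike_sup :: "('x::finite, 'a) mdp \<Rightarrow> real set \<Rightarrow> enat" where
  "turnpike_sup M E = (SUP \<alpha>\<in>E. turnpike M \<alpha>)"

definition R1_star :: "('x::finite, 'a) mdp \<Rightarrow> real" where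
  "R1_star M = 1/2 * (Max (\<Union>x. reward M x ` actions M x) - Min (\<Union>x. reward M x ` actions M x))"

definition R2_star :: "('x::finite, 'a) mdp \<Rightarrow> real" where
  "R2_star M = 1/2 * (Max (range (terminal M)) - Min (range (terminal M)))"

definition R_star :: "('x::finite, 'a) mdp \<Rightarrow> real" where
  "R_star M = max (R1_star M) (R2_star M)"

text \<open>
  The sequence \<open>A\<^sub>n\<close> starts at \<open>n = -1\<close>; \<open>act_before M n\<close> is \<open>A\<^bsub>n-1\<^esub>\<close>. The three functions
  \<open>g_seq M n\<close> (that is, \<open>g\<^sub>n\<close>), \<open>r_seq M n\<close> (that is, \<open>r\<^sub>n\<close>) and \<open>act_before M n\<close> are
  defined simultaneously.
\<close>

definition argmax_set :: "('a \<Rightarrow> real) \<Rightarrow> 'a set \<Rightarrow> 'a set" where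
  "argmax_set f B = {a. is_arg_max f (\<lambda>b. b \<in> B) a}"

function g_seq :: "('x::finite, 'a) mdp \<Rightarrow> nat \<Rightarrow> 'x \<Rightarrow> 'a \<Rightarrow> real"
  and r_seq :: "('x::finite, 'a) mdp \<Rightarrow> nat \<Rightarrow> 'x \<Rightarrow> real"
  and act_before :: "('x::finite, 'a) mdp \<Rightarrow> nat \<Rightarrow> 'x \<Rightarrow> 'a set" where
  "g_seq M 0 x a = reward M x a"
| "g_seq M (Suc n) x a = (\<Sum>y\<in>UNIV. trans_prob M x a y * r_seq M n y)"
| "r_seq M n x = Max (g_seq M n x ` act_before M n x)"
| "act_before M 0 x = actions M x"
| "act_before M (Suc n) x = argmax_set (g_seq M n x) (act_before M n x)"
  by pat_completeness auto
termination
  by (relation "Wellfounded.measure (\<lambda>z. case z of Inl (M, n, x, a) \<Rightarrow> 2 * n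
        | Inr (Inl (M, n, x)) \<Rightarrow> 2 * n + 1 | Inr (Inr (M, n, x)) \<Rightarrow> 2 * n)") auto

declare r_seq.simps [simp del]

definition act_seq :: "('x::finite, 'a) mdp \<Rightarrow> nat \<Rightarrow> 'x \<Rightarrow> 'a set" where
  "act_seq M n = act_before M (Suc n)"

definition F_seq :: "('x::finite, 'a) mdp \<Rightarrow> nat \<Rightarrow> ('x \<Rightarrow> 'a) set" where
  "F_seq M n = {\<phi> \<in> decision_rules M. \<forall>x. \<phi> x \<in> act_seq M n x}"

definition X_seq :: "('x::finite, 'a) mdp \<Rightarrow> nat \<Rightarrow> 'x set" where
  "X_seq M n = {x. act_seq M n x \<noteq> act_before M n x}"

definition L_idx :: "('x::finite, 'a) mdp \<Rightarrow> nat" where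
  "L_idx M = (LEAST K. \<forall>n\<ge>K. F_seq M n = F_seq M (n + 1))"

text \<open>Likewise \<open>C_before M n\<close> is \<open>C\<^bsub>n-1\<^esub>\<close>.\<close>

primrec C_before :: "('x::finite, 'a) mdp \<Rightarrow> nat \<Rightarrow> ereal" where
  "C_before M 0 = \<infinity>"
| "C_before M (Suc n) =
    (if X_seq M n = {} then C_before M n
     else min (C_before M n)
       (ereal (Min ((\<lambda>x. r_seq M n x - Max (g_seq M n x ` (act_before M n x - act_seq M n x)))
                      ` X_seq M n))))"

definition C_seq :: "('x::finite, 'a) mdp \<Rightarrow> nat \<Rightarrow> ereal" where
  "C_seq M n = C_before M (Suc n)"

definition Delta :: "('x::finite, 'a) mdp \<Rightarrow> nat \<Rightarrow> real" where
  "Delta M n =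
    (if C_seq M n = \<infinity> then 1
     else real_of_ereal (C_seq M n) / (2 * R_star M + real_of_ereal (C_seq M n)))"

end

theory Submission
  imports Defs
begin

text \<open>
  Every value function has span at most \<open>b = 2R\<^sup>*/(1-\<alpha>)\<close>, and \<open>\<alpha> < \<Delta>\<^sub>L\<close> says that \<open>\<alpha> b\<close> is smaller than
  each gap \<open>r\<^sub>n(x) - g\<^sub>n(x,a)\<close> with \<open>a \<in> A\<^bsub>n-1\<^esub>(x) - A\<^sub>n(x)\<close>, \<open>n \<le> L\<close>. If
  \<open>V = r\<^sub>0 + \<alpha> r\<^sub>1 + \<dots> + \<alpha>\<^bsup>k-1\<^esup> r\<^bsub>k-1\<^esub> + \<alpha>\<^sup>k W\<close> with the span of \<open>W\<close> at most \<open>b\<close>, then the remainder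
  cannot outweigh a gap, so policies greedy for \<open>V\<close> choose lexicographically, i.e. from \<open>A\<^sub>k\<close>, and
  the next iterate has such an expansion of length \<open>k + 1\<close>. Hence \<open>D\<^sub>n(\<alpha>) \<subseteq> \<F>\<^sub>L = D(\<alpha>)\<close> for
  \<open>n > L\<close>, while under the hypothesis of (b) all of \<open>\<F>\<^bsub>L-1\<^esub>\<close> lies in \<open>D\<^sub>L(\<alpha>)\<close>. The bound
  \<open>L < m\<close> is a Krylov argument: once \<open>r\<^sub>k\<close> lies in the span of \<open>1, r\<^sub>0, \<dots>, r\<^bsub>k-1\<^esub>\<close>, all \<open>P(\<phi>)\<close> with
  \<open>\<phi> \<in> \<F>\<^sub>k\<close> agree on this invariant subspace and no further action is discarded.
\<close>

section \<open>One-step values, greedy rules and truncated expansions in powers of \<alpha>\<close>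

definition q_val :: "('x::finite, 'a) mdp \<Rightarrow> real \<Rightarrow> real ^ 'x \<Rightarrow> 'x \<Rightarrow> 'a \<Rightarrow> real" where
  "q_val M \<alpha> V x a = reward M x a + \<alpha> * (\<Sum>y\<in>UNIV. trans_prob M x a y * V $ y)"

definition greedy :: "('x::finite, 'a) mdp \<Rightarrow> real \<Rightarrow> real ^ 'x \<Rightarrow> ('x \<Rightarrow> 'a) \<Rightarrow> bool" where
  "greedy M \<alpha> V \<phi> \<longleftrightarrow>
     \<phi> \<in> decision_rules M \<and> (\<forall>x. \<forall>a\<in>actions M x. q_val M \<alpha> V x a \<le> q_val M \<alpha> V x (\<phi> x))"

text \<open>The remainder \<open>W\<close> is controlled only through its span: additive constants
  do not affect greedy choices, and averaging with transition probabilities cannot widen the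
  span.\<close>

definition expands :: "('x::finite, 'a) mdp \<Rightarrow> real \<Rightarrow> real \<Rightarrow> nat \<Rightarrow> real ^ 'x \<Rightarrow> bool" where
  "expands M \<alpha> b k V \<longleftrightarrow>
     (\<exists>W. (\<forall>x y. W x - W y \<le> b) \<and>
          (\<forall>x. V $ x = (\<Sum>j<k. \<alpha> ^ j * r_seq M j x) + \<alpha> ^ k * W x))"

text \<open>The \<open>p\<close>-average is compared with \<open>w y\<close> for each fixed
  \<open>y\<close>, and the result is then averaged over \<open>y\<close> with weights
  \<open>q\<close>.\<close>

lemma expectation_diff_le:
  fixes p q w :: "'x::finite \<Rightarrow> real"
  assumes p: "\<And>x. 0 \<le> p x" "sum p UNIV = 1" and q: "\<And>x. 0 \<le> q x" "sum q UNIV = 1"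
    and w: "\<And>x y. w x - w y \<le> b"
  shows "(\<Sum>x\<in>UNIV. p x * w x) - (\<Sum>x\<in>UNIV. q x * w x) \<le> b"
proof -
  have "(\<Sum>x\<in>UNIV. p x * w x) \<le> b + w y" for y
  proof -
    have "(\<Sum>x\<in>UNIV. p x * w x) \<le> (\<Sum>x\<in>UNIV. p x * (b + w y))"
      using w[of _ y] p(1) by (intro sum_mono mult_left_mono) (auto simp: algebra_simps)
    then show ?thesis using p(2) by (simp flip: sum_distrib_right)
  qed
  then have "(\<Sum>y\<in>UNIV. q y * ((\<Sum>x\<in>UNIV. p x * w x) - b)) \<le> (\<Sum>y\<in>UNIV. q y * w y)"
    using q(1) by (intro sum_mono mult_left_mono) (auto simp: algebra_simps)
  then show ?thesis using q(2) by (simp flip: sum_distrib_right)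
qed

lemma argmax_set_eq:
  assumes "finite B" "B \<noteq> {}"
  shows "argmax_set f B = {a \<in> B. f a = Max (f ` B)}"
  using assms by (auto simp: argmax_set_def is_arg_max_linorder intro!: antisym[OF _ Max.boundedI])

lemma P_mat_mult_nth:
  "(P_mat M \<phi> *v V) $ x = (\<Sum>y\<in>UNIV. trans_prob M x (\<phi> x) y * V $ y)"
  by (simp add: P_mat_def matrix_vector_mult_def)

lemma T_op_nth: "T_op M \<alpha> \<phi> V $ x = q_val M \<alpha> V x (\<phi> x)"
  by (simp add: T_op_def r_vec_def q_val_def P_mat_mult_nth)

text \<open>One step shifts the series: the reward is g_0, and averaging r_j over the next state
  gives g_(j+1). Keeping g instead of r makes this valid for every action, discarded or not.\<close>

lemma q_val_expansion:
  assumes "\<And>y. V $ y = (\<Sum>j<k. \<alpha> ^ j * r_seq M j y) + \<alpha> ^ k * W y"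
  shows "q_val M \<alpha> V x a =
    (\<Sum>j<Suc k. \<alpha> ^ j * g_seq M j x a) + \<alpha> ^ Suc k * (\<Sum>y\<in>UNIV. trans_prob M x a y * W y)"
proof -
  have "(\<Sum>y\<in>UNIV. trans_prob M x a y * V $ y) =
      (\<Sum>y\<in>UNIV. \<Sum>j<k. \<alpha> ^ j * (trans_prob M x a y * r_seq M j y))
      + \<alpha> ^ k * (\<Sum>y\<in>UNIV. trans_prob M x a y * W y)"
    by (simp add: assms algebra_simps sum.distrib sum_distrib_left)
  also have "(\<Sum>y\<in>UNIV. \<Sum>j<k. \<alpha> ^ j * (trans_prob M x a y * r_seq M j y)) =
      (\<Sum>j<k. \<alpha> ^ j * g_seq M (Suc j) x a)"
    by (subst sum.swap) (simp add: sum_distrib_left)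
  finally show ?thesis
    unfolding q_val_def sum.lessThan_Suc_shift by (simp add: algebra_simps sum_distrib_left del: g_seq.simps(2))
qed

context finite_mdp
begin

section \<open>The decreasing action sets and their decision rules\<close>

lemma finite_act_before: "finite (act_before M n x)"
  and act_before_nonempty: "act_before M n x \<noteq> {}"
proof -
  have "finite (act_before M n x) \<and> act_before M n x \<noteq> {}"
  proof (induction n)
    case 0
    then show ?case by (simp add: finite_actions actions_nonempty)
  next
    case (Suc n)
    then have "Max (g_seq M n x ` act_before M n x) \<in> g_seq M n x ` act_before M n x"
      by (intro Max_in) auto
    with Suc show ?case by (auto simp: argmax_set_eq image_iff)
  qed
  then show "finite (act_before M n x)" "act_before M n x \<noteq> {}" by auto
qed

lemma act_before_Suc_eq: "act_before M (Suc n) x = {a \<in> act_before M n x. g_seq M n x a = r_seq M n x}"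
  by (simp add: argmax_set_eq finite_act_before act_before_nonempty r_seq.simps)

declare act_before.simps(2) [simp del]

lemma g_seq_le_r_seq: "a \<in> act_before M n x \<Longrightarrow> g_seq M n x a \<le> r_seq M n x"
  by (simp add: r_seq.simps finite_act_before)

lemma act_before_antimono: "m \<le> n \<Longrightarrow> act_before M n x \<subseteq> act_before M m x"
  by (induction rule: dec_induct) (auto simp: act_before_Suc_eq)

lemma act_before_subset_actions: "act_before M n x \<subseteq> actions M x"
  using act_before_antimono[of 0 n] by simp

lemma g_seq_eq_r_seq:
  assumes "a \<in> act_before M n x" "j < n"
  shows "g_seq M j x a = r_seq M j x"
  using act_before_antimono[of "Suc j" n x] assms by (auto simp: act_before_Suc_eq)

lemma F_seq_iff: "\<phi> \<in> F_seq M n \<longleftrightarrow> (\<forall>x. \<phi> x \<in> act_before M (Suc n) x)"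
  using act_before_subset_actions by (fastforce simp: F_seq_def decision_rules_def act_seq_def)

lemma F_seq_eq_iff: "F_seq M m = F_seq M n \<longleftrightarrow> act_before M (Suc m) = act_before M (Suc n)"
proof
  have *: "a \<in> act_before M (Suc n) x" if "F_seq M m \<subseteq> F_seq M n" "a \<in> act_before M (Suc m) x" for m n a x
  proof -
    \<comment> \<open>The rules form a product set, so \<open>a\<close> can be prescribed at
      \<open>x\<close> and completed arbitrarily at the other states.\<close>
    have "(\<lambda>y. if y = x then a else (SOME a. a \<in> act_before M (Suc m) y)) \<in> F_seq M m"
      using that(2) act_before_nonempty by (auto simp: F_seq_iff some_in_eq)
    with that(1) have "(\<lambda>y. if y = x then a else (SOME a. a \<in> act_before M (Suc m) y)) \<in> F_seq M n" by auto
    then show ?thesis unfolding F_seq_iff by (metis (full_types))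
  qed
  assume "F_seq M m = F_seq M n"
  with *[of m n] *[of n m] show "act_before M (Suc m) = act_before M (Suc n)"
    by (intro ext) blast
qed (auto simp: F_seq_iff)

subsection \<open>Stabilisation of the action sets\<close>

text \<open>Averaging with an action of A_k sends the constant 1 to itself and r_j to r_(j+1) for j
  < k. By the assumption on r_k the span is invariant, and the actions of A_k(x) cannot be told
  apart on it; hence all later g_n are constant on them.\<close>

lemma act_before_stable_of_span:
  assumes k: "(\<chi> x. r_seq M k x) \<in> span (insert 1 ((\<lambda>j. \<chi> x. r_seq M j x) ` {..<k}))" (is "?r k \<in> span ?U")
    and "k \<le> n"
  shows "act_before M (Suc n) = act_before M (Suc k)"
proof -
  let ?p = "\<lambda>x a v. \<Sum>y\<in>UNIV. trans_prob M x a y * v $ y"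
  have lin: "(\<Sum>y\<in>UNIV. trans_prob M x a y * (c * u $ y + v $ y)) = c * ?p x a u + ?p x a v" for x a c u v
    by (simp add: algebra_simps sum.distrib sum_distrib_left)
  have agree: "\<exists>w\<in>span ?U. \<forall>x. \<forall>a\<in>act_before M (Suc k) x. ?p x a v = w $ x" if "v \<in> span ?U" for v
    using that
  proof (induction rule: span_induct_alt)
    case base
    show ?case by (intro bexI[of _ 0]) (auto simp: span_zero)
  next
    case (step c u v)
    have "\<exists>w\<in>span ?U. \<forall>x. \<forall>a\<in>act_before M (Suc k) x. ?p x a u = w $ x"
    proof (cases "u = 1")
      case True
      then show ?thesis using act_before_subset_actions
        by (intro bexI[of _ 1]) (auto simp: span_base trans_prob_sum subset_iff)
    next
      case False
      with step(1) obtain j where j: "j < k" "u = ?r j" by auto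
      have "?p x a u = ?r (Suc j) $ x" if "a \<in> act_before M (Suc k) x" for x a
        using g_seq_eq_r_seq[OF that, of "Suc j"] j by simp
      moreover have "?r (Suc j) \<in> span ?U"
        \<comment> \<open>The image of the last generator is r_k, which is in the span by
          assumption; the other images are generators.\<close>
        using j k by (cases "Suc j = k") (auto intro!: span_base)
      ultimately show ?thesis by blast
    qed
    then obtain w1 where w1: "w1 \<in> span ?U" "\<And>x a. a \<in> act_before M (Suc k) x \<Longrightarrow> ?p x a u = w1 $ x" by blast
    from step(2) obtain w2 where w2: "w2 \<in> span ?U" "\<And>x a. a \<in> act_before M (Suc k) x \<Longrightarrow> ?p x a v = w2 $ x" by blast
    show ?case
      using w1 w2 by (intro bexI[of _ "c *\<^sub>R w1 + w2"])
        (simp_all add: lin span_add span_scale)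
  qed
  \<comment> \<open>Membership of r_n in the span is carried along so that \<open>agree\<close>
    applies to the next g.\<close>
  have "act_before M (Suc n) = act_before M (Suc k) \<and> ?r n \<in> span ?U"
    using \<open>k \<le> n\<close>
  proof (induction rule: dec_induct)
    case base
    then show ?case using k by simp
  next
    case (step n)
    then obtain w where w: "w \<in> span ?U" "\<And>x a. a \<in> act_before M (Suc n) x \<Longrightarrow> g_seq M (Suc n) x a = w $ x"
      using agree[of "?r n"] by auto
    have r: "r_seq M (Suc n) x = w $ x" for x
    proof -
      have "g_seq M (Suc n) x ` act_before M (Suc n) x = {w $ x}"
        using w(2) act_before_nonempty[of "Suc n" x] by (auto simp: image_iff simp del: g_seq.simps)
      then show ?thesis by (simp add: r_seq.simps del: g_seq.simps)
    qed
    then have "act_before M (Suc (Suc n)) = act_before M (Suc n)"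
      using w(2) by (intro ext) (auto simp: act_before_Suc_eq[of "Suc n"] simp del: g_seq.simps)
    moreover have "?r (Suc n) = w" by (simp add: r vec_eq_iff)
    ultimately show ?case using step w(1) by simp
  qed
  then show ?thesis by simp
qed

text \<open>Otherwise 1, r_0, ..., r_(m-1) would be m + 1 independent vectors in dimension m. The
  generator 1 is what makes the bound on \<open>k\<close> strict, hence L + 1 \<le> m.\<close>

lemma r_seq_in_span:
  "\<exists>k<CARD('x). (\<chi> x. r_seq M k x) \<in> span (insert 1 ((\<lambda>j. \<chi> x. r_seq M j x) ` {..<k}))"
    (is "\<exists>k<_. ?r k \<in> span (?U k)")
proof (rule ccontr)
  assume *: "\<not> ?thesis"
  have "dim (?U k) = k + 1" if "k \<le> CARD('x)" for k
    using that
  proof (induction k)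
    case 0
    then show ?case by (simp add: dim_insert vec_eq_iff)
  next
    case (Suc k)
    have "?U (Suc k) = insert (?r k) (?U k)" by (simp add: lessThan_Suc insert_commute)
    then have "dim (?U (Suc k)) = (if ?r k \<in> span (?U k) then dim (?U k) else dim (?U k) + 1)"
      by (simp only: dim_insert)
    moreover have "?r k \<notin> span (?U k)" using * Suc.prems by auto
    ultimately show ?case using Suc by simp
  qed
  then have "dim (?U CARD('x)) = CARD('x) + 1" by blast
  moreover have "dim (?U CARD('x)) \<le> CARD('x)"
    using dim_subset_UNIV[of "?U CARD('x)"] by (simp only: DIM_cart DIM_real mult_1_right)
  ultimately show False by linarith
qed

lemma F_seq_stable: "\<exists>K<CARD('x). \<forall>n\<ge>K. F_seq M n = F_seq M (n + 1)"
proof -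
  obtain k where k: "k < CARD('x)" "(\<chi> x. r_seq M k x) \<in> span (insert 1 ((\<lambda>j. \<chi> x. r_seq M j x) ` {..<k}))"
    using r_seq_in_span by auto
  have "F_seq M n = F_seq M (n + 1)" if "n \<ge> k" for n
    using act_before_stable_of_span[OF k(2), of n] act_before_stable_of_span[OF k(2), of "n + 1"] that
    by (simp add: F_seq_eq_iff)
  with k(1) show ?thesis by blast
qed

lemma L_idx_less_card: "L_idx M < CARD('x)"
  using F_seq_stable Least_le[of "\<lambda>K. \<forall>n\<ge>K. F_seq M n = F_seq M (n + 1)"]
  unfolding L_idx_def by (meson le_less_trans)

lemma F_seq_after_L_idx: "n \<ge> L_idx M \<Longrightarrow> F_seq M n = F_seq M (n + 1)"
  using F_seq_stable LeastI_ex[of "\<lambda>K. \<forall>n\<ge>K. F_seq M n = F_seq M (n + 1)"]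
  unfolding L_idx_def by blast

lemma act_before_after_L_idx:
  assumes "n \<ge> L_idx M"
  shows "act_before M (Suc n) = act_before M (Suc (L_idx M))"
  using assms
proof (induction rule: dec_induct)
  case (step n)
  then show ?case using F_seq_after_L_idx[of n] by (simp add: F_seq_eq_iff)
qed simp

text \<open>By minimality of L: equality would let the stable range begin at L - 1. This supplies
  the rule that is discarded last.\<close>

lemma F_seq_before_L_idx:
  assumes "L_idx M = Suc l"
  shows "F_seq M l \<noteq> F_seq M (L_idx M)"
proof
  assume eq: "F_seq M l = F_seq M (L_idx M)"
  have "F_seq M n = F_seq M (n + 1)" if "n \<ge> l" for n
    using that eq assms F_seq_after_L_idx[of n] by (cases "n = l") auto
  then have "L_idx M \<le> l" unfolding L_idx_def by (intro Least_le) blast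
  with assms show False by simp
qed

text \<open>The sets decrease up to A_L and are constant from there on, so a rule in
  \<open>F_seq M (L_idx M)\<close> is admissible at every stage.\<close>

lemma act_before_L_idx_subset: "act_before M (Suc (L_idx M)) x \<subseteq> act_before M n x"
proof (cases "n \<le> Suc (L_idx M)")
  case True
  then show ?thesis by (rule act_before_antimono)
next
  case False
  then show ?thesis using act_before_after_L_idx[of "n - 1"] by simp
qed

lemma F_seq_nonempty: "F_seq M n \<noteq> {}"
proof -
  have "(\<lambda>y. SOME a. a \<in> act_before M (Suc n) y) \<in> F_seq M n"
    using act_before_nonempty by (auto simp: F_seq_iff some_in_eq)
  then show ?thesis by blast
qed

subsection \<open>The gap constant\<close>

text \<open>A discarded action has g strictly below r, and only finitely many gaps enter the
  minimum.\<close>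

lemma C_before_pos: "0 < C_before M n"
proof (induction n)
  case (Suc n)
  have "0 < Min ((\<lambda>x. r_seq M n x - Max (g_seq M n x ` (act_before M n x - act_seq M n x))) ` X_seq M n)"
    if "X_seq M n \<noteq> {}"
  proof -
    have "Max (g_seq M n x ` (act_before M n x - act_seq M n x)) < r_seq M n x" if "x \<in> X_seq M n" for x
    proof (subst Max_less_iff)
      show "finite (g_seq M n x ` (act_before M n x - act_seq M n x))" by (simp add: finite_act_before)
      show "g_seq M n x ` (act_before M n x - act_seq M n x) \<noteq> {}"
        using that by (auto simp: X_seq_def act_seq_def act_before_Suc_eq)
      show "\<forall>a\<in>g_seq M n x ` (act_before M n x - act_seq M n x). a < r_seq M n x"
        using g_seq_le_r_seq by (force simp: act_seq_def act_before_Suc_eq less_le)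
    qed
    with that show ?thesis by (subst Min_gr_iff) auto
  qed
  with Suc show ?case by auto
qed simp

lemma C_before_antimono: "m \<le> n \<Longrightarrow> C_before M n \<le> C_before M m"
  by (rule lift_Suc_antimono_le) simp

lemma C_before_le_gap:
  assumes "a \<in> act_before M n x" "a \<notin> act_before M (Suc n) x" "n < k"
  shows "C_before M k \<le> ereal (r_seq M n x - g_seq M n x a)"
proof -
  have x: "x \<in> X_seq M n" using assms by (auto simp: X_seq_def act_seq_def)
  have "Min ((\<lambda>x. r_seq M n x - Max (g_seq M n x ` (act_before M n x - act_seq M n x))) ` X_seq M n)
      \<le> r_seq M n x - Max (g_seq M n x ` (act_before M n x - act_seq M n x))"
    using x by (intro Min_le) auto
  also have "\<dots> \<le> r_seq M n x - g_seq M n x a"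
    using assms by (intro diff_left_mono Max_ge) (auto simp: finite_act_before act_seq_def)
  finally have "C_before M (Suc n) \<le> ereal (r_seq M n x - g_seq M n x a)"
    using x by (auto simp: min_le_iff_disj)
  moreover have "C_before M k \<le> C_before M (Suc n)"
    using \<open>n < k\<close> by (intro C_before_antimono) simp
  ultimately show ?thesis by (rule order_trans[rotated])
qed

lemma R_star_bounds:
  assumes "a \<in> actions M x" "b \<in> actions M y"
  shows "reward M x a - reward M y b \<le> 2 * R_star M"
proof -
  have "finite (\<Union>x. reward M x ` actions M x)" by (simp add: finite_actions)
  then have "reward M x a \<le> Max (\<Union>x. reward M x ` actions M x)"
    "Min (\<Union>x. reward M x ` actions M x) \<le> reward M y b"
    using assms by (auto intro!: Max_ge Min_le)
  then have "reward M x a - reward M y b \<le> 2 * R1_star M" by (simp add: R1_star_def)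
  also have "\<dots> \<le> 2 * R_star M" by (simp add: R_star_def)
  finally show ?thesis .
qed

lemma terminal_span: "terminal M x - terminal M y \<le> 2 * R_star M"
proof -
  have "terminal M x \<le> Max (range (terminal M))" "Min (range (terminal M)) \<le> terminal M y"
    by (auto intro!: Max_ge Min_le)
  from diff_mono[OF this] have "terminal M x - terminal M y \<le> 2 * R2_star M" by (simp add: R2_star_def)
  also have "\<dots> \<le> 2 * R_star M" by (simp add: R_star_def)
  finally show ?thesis .
qed

lemma R_star_nonneg: "0 \<le> R_star M"
  using terminal_span[of undefined undefined] by simp

lemma Delta_le_1: "Delta M n \<le> 1"
proof (cases "C_seq M n")
  case (real c)
  then have "0 < c" using C_before_pos[of "Suc n"] by (simp add: C_seq_def)
  with real R_star_nonneg show ?thesis by (simp add: Delta_def)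
\<comment> \<open>Positivity excludes the value minus infinity; at plus infinity the threshold is 1
  by convention.\<close>
qed (use C_before_pos[of "Suc n"] in \<open>auto simp: Delta_def C_seq_def\<close>)

text \<open>For \<open>c\<close> = C_k the inequality \<alpha> < c / (2 R* + c) rearranges to
  \<alpha> * 2 R* / (1 - \<alpha>) < c, and \<open>c\<close> is a lower bound for all gaps up to
  stage \<open>k\<close>.\<close>

lemma gap_of_less_Delta:
  assumes "\<alpha> < Delta M k" "n \<le> k" "a \<in> act_before M n x" "a \<notin> act_before M (Suc n) x"
  shows "\<alpha> * (2 * R_star M / (1 - \<alpha>)) < r_seq M n x - g_seq M n x a"
proof -
  have le: "C_seq M k \<le> ereal (r_seq M n x - g_seq M n x a)"
    using C_before_le_gap[OF assms(3,4)] assms(2) by (simp add: C_seq_def del: C_before.simps)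
  \<comment> \<open>The discarded action \<open>a\<close> makes C_k finite, so the threshold is the
    fraction.\<close>
  with C_before_pos[of "Suc k"] obtain c where c: "C_seq M k = ereal c" "0 < c"
    unfolding C_seq_def by (cases "C_before M (Suc k)") auto
  have "\<alpha> < c / (2 * R_star M + c)" using assms(1) c by (simp add: Delta_def)
  then have "\<alpha> * (2 * R_star M + c) < c" using c(2) R_star_nonneg by (simp add: pos_less_divide_eq)
  moreover have "\<alpha> < 1" using assms(1) Delta_le_1[of k] by simp
  ultimately have "\<alpha> * (2 * R_star M / (1 - \<alpha>)) < c" by (simp add: field_simps)
  with le c(1) show ?thesis by simp
qed

subsection \<open>Value functions\<close>

lemma expectation_diff_actions:
  assumes "a \<in> actions M x" "a' \<in> actions M x'" "\<And>y z. w y - w z \<le> b"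
  shows "(\<Sum>y\<in>UNIV. trans_prob M x a y * w y) - (\<Sum>y\<in>UNIV. trans_prob M x' a' y * w y) \<le> b"
  using assms by (intro expectation_diff_le) (auto simp: trans_prob_nonneg trans_prob_sum)

lemma q_val_diff_le:
  assumes "0 \<le> \<alpha>" "a \<in> actions M x" "a' \<in> actions M x'" "\<And>y z. V $ y - V $ z \<le> b"
  shows "q_val M \<alpha> V x a - q_val M \<alpha> V x' a' \<le> 2 * R_star M + \<alpha> * b"
  using R_star_bounds[OF assms(2,3)]
    mult_left_mono[OF expectation_diff_actions[OF assms(2,3), of "($) V", OF assms(4)] assms(1)]
  by (simp add: q_val_def algebra_simps)

text \<open>A rule can be altered at the single state \<open>x\<close>, so maximising over rules at
  \<open>x\<close> is maximising over the actions there.\<close>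

lemma T_op_image: "(\<lambda>\<phi>. T_op M \<alpha> \<phi> V $ x) ` decision_rules M = q_val M \<alpha> V x ` actions M x"
proof (intro equalityI subsetI)
  fix v assume "v \<in> q_val M \<alpha> V x ` actions M x"
  then obtain a where a: "a \<in> actions M x" "v = q_val M \<alpha> V x a" by auto
  have "(\<lambda>y. if y = x then a else (SOME a. a \<in> actions M y)) \<in> decision_rules M"
    using a actions_nonempty by (auto simp: decision_rules_def some_in_eq)
  then show "v \<in> (\<lambda>\<phi>. T_op M \<alpha> \<phi> V $ x) ` decision_rules M"
    using a by (intro image_eqI) (simp_all add: T_op_nth)
qed (auto simp: T_op_nth decision_rules_def)

lemma V_fin_Suc_nth: "V_fin M \<alpha> (Suc n) $ x = Max (q_val M \<alpha> (V_fin M \<alpha> n) x ` actions M x)"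
  by (simp add: T_op_image)

declare V_fin.simps(2) [simp del]

lemma greedy_iff:
  "greedy M \<alpha> V \<phi> \<longleftrightarrow> \<phi> \<in> decision_rules M \<and> (\<forall>x. T_op M \<alpha> \<phi> V $ x = Max (q_val M \<alpha> V x ` actions M x))"
proof -
  have "(\<forall>a\<in>actions M x. q_val M \<alpha> V x a \<le> q_val M \<alpha> V x (\<phi> x)) \<longleftrightarrow>
      q_val M \<alpha> V x (\<phi> x) = Max (q_val M \<alpha> V x ` actions M x)" if "\<phi> x \<in> actions M x" for x
    using that finite_actions[of x] by (auto intro!: Max_eqI[symmetric])
  then show ?thesis by (auto simp: greedy_def T_op_nth decision_rules_def)
qed

lemma greedy_exists: "\<exists>\<phi>. greedy M \<alpha> V \<phi>"
proof -
  have "\<exists>a\<in>actions M x. q_val M \<alpha> V x a = Max (q_val M \<alpha> V x ` actions M x)" for x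
    using Max_in[of "q_val M \<alpha> V x ` actions M x"] finite_actions actions_nonempty by fastforce
  then show ?thesis unfolding greedy_iff T_op_nth decision_rules_def by (auto intro!: choice dest: bchoice) metis
qed

lemma D_fin_Suc_iff: "\<phi> \<in> D_fin M (Suc n) \<alpha> \<longleftrightarrow> greedy M \<alpha> (V_fin M \<alpha> n) \<phi>"
  by (auto simp: D_fin_def greedy_iff vec_eq_iff V_fin_Suc_nth)

text \<open>The bound is the fixed point of b \<mapsto> 2 R* + \<alpha> b, which is how one
  iteration changes a span bound; the terminal reward starts below it.\<close>

lemma V_fin_span:
  assumes "0 \<le> \<alpha>" "\<alpha> < 1"
  shows "V_fin M \<alpha> n $ x - V_fin M \<alpha> n $ y \<le> 2 * R_star M / (1 - \<alpha>)"
proof (induction n arbitrary: x y)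
  case 0
  have "2 * R_star M \<le> 2 * R_star M / (1 - \<alpha>)"
    using assms R_star_nonneg by (simp add: field_simps mult_nonneg_nonneg)
  with terminal_span[of x y] show ?case by (simp add: s_vec_def)
next
  case (Suc n)
  obtain \<phi> where \<phi>: "greedy M \<alpha> (V_fin M \<alpha> n) \<phi>" using greedy_exists by blast
  then have "V_fin M \<alpha> (Suc n) $ z = q_val M \<alpha> (V_fin M \<alpha> n) z (\<phi> z)" for z
    by (simp add: greedy_iff V_fin_Suc_nth T_op_nth)
  moreover have "\<phi> z \<in> actions M z" for z using \<phi> by (simp add: greedy_def decision_rules_def)
  ultimately have "V_fin M \<alpha> (Suc n) $ x - V_fin M \<alpha> (Suc n) $ y \<le> 2 * R_star M + \<alpha> * (2 * R_star M / (1 - \<alpha>))"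
    using q_val_diff_le[OF assms(1) _ _ Suc] by simp
  also have "\<dots> = 2 * R_star M / (1 - \<alpha>)" using assms by (simp add: field_simps)
  finally show ?case .
qed

section \<open>Propagation of expansions and lexicographic choice\<close>

lemma expands_0: "(\<And>x y. V $ x - V $ y \<le> b) \<Longrightarrow> expands M \<alpha> b 0 V"
  by (auto simp: expands_def intro!: exI[of _ "($) V"])

lemma expands_Suc:
  assumes "expands M \<alpha> b k V" "\<And>x. \<phi> x \<in> act_before M (Suc k) x"
  shows "expands M \<alpha> b (Suc k) (T_op M \<alpha> \<phi> V)"
proof -
  obtain W where W: "\<And>x y. W x - W y \<le> b" "\<And>x. V $ x = (\<Sum>j<k. \<alpha> ^ j * r_seq M j x) + \<alpha> ^ k * W x"
    using assms(1) by (auto simp: expands_def)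
  have "\<phi> x \<in> actions M x" for x using assms(2) act_before_subset_actions by blast
  then have "(\<Sum>y\<in>UNIV. trans_prob M x (\<phi> x) y * W y) - (\<Sum>y\<in>UNIV. trans_prob M x' (\<phi> x') y * W y) \<le> b" for x x'
    by (intro expectation_diff_actions W)
  moreover have "T_op M \<alpha> \<phi> V $ x = (\<Sum>j<Suc k. \<alpha> ^ j * r_seq M j x)
      + \<alpha> ^ Suc k * (\<Sum>y\<in>UNIV. trans_prob M x (\<phi> x) y * W y)" for x
    using g_seq_eq_r_seq[OF assms(2)] by (simp add: T_op_nth q_val_expansion[OF W(2)] del: sum.lessThan_Suc)
  ultimately show ?thesis unfolding expands_def
    by (intro exI[of _ "\<lambda>x. \<Sum>y\<in>UNIV. trans_prob M x (\<phi> x) y * W y"]) auto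
qed

text \<open>If the greedy action first leaves the action sets at stage k, an action of A_k agrees
  with it in all orders below k and wins by \<alpha>^k times the gap at order k. The remainders can
  give back at most \<alpha>^(k+1) b, which is less.\<close>

lemma greedy_in_act_before:
  assumes "0 < \<alpha>" and gr: "greedy M \<alpha> V \<phi>"
    and gap: "\<And>j x a. j < k \<Longrightarrow> a \<in> act_before M j x \<Longrightarrow> a \<notin> act_before M (Suc j) x \<Longrightarrow>
      \<alpha> * b < r_seq M j x - g_seq M j x a"
    and "\<And>j. j < k \<Longrightarrow> expands M \<alpha> b j V"
  shows "\<phi> x \<in> act_before M k x"
  using gap assms(4)
proof (induction k)
  case 0
  then show ?case using gr by (auto simp: greedy_def decision_rules_def)
next
  case (Suc k)
  then have in_k: "\<phi> x \<in> act_before M k x" by simp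
  show ?case
  proof (rule ccontr)
    assume out: "\<phi> x \<notin> act_before M (Suc k) x"
    from Suc.prems(1)[OF _ in_k out] have gap: "\<alpha> * b < r_seq M k x - g_seq M k x (\<phi> x)" by simp
    obtain W where W: "\<And>x y. W x - W y \<le> b" "\<And>x. V $ x = (\<Sum>j<k. \<alpha> ^ j * r_seq M j x) + \<alpha> ^ k * W x"
      using Suc.prems(2)[of k] by (auto simp: expands_def)
    let ?E = "\<lambda>a. \<Sum>y\<in>UNIV. trans_prob M x a y * W y"
    obtain a where a: "a \<in> act_before M (Suc k) x" using act_before_nonempty by blast
    have "q_val M \<alpha> V x a = (\<Sum>j<k. \<alpha> ^ j * r_seq M j x) + \<alpha> ^ k * r_seq M k x + \<alpha> ^ Suc k * ?E a"
      using g_seq_eq_r_seq[OF a] by (simp add: q_val_expansion[OF W(2)])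
    moreover have "q_val M \<alpha> V x (\<phi> x) =
        (\<Sum>j<k. \<alpha> ^ j * r_seq M j x) + \<alpha> ^ k * g_seq M k x (\<phi> x) + \<alpha> ^ Suc k * ?E (\<phi> x)"
      using g_seq_eq_r_seq[OF in_k] by (simp add: q_val_expansion[OF W(2)])
    ultimately have "q_val M \<alpha> V x a - q_val M \<alpha> V x (\<phi> x) =
        \<alpha> ^ k * ((r_seq M k x - g_seq M k x (\<phi> x)) - \<alpha> * (?E (\<phi> x) - ?E a))"
      by (simp add: algebra_simps)
    moreover have "\<alpha> * (?E (\<phi> x) - ?E a) \<le> \<alpha> * b"
      using \<open>0 < \<alpha>\<close> in_k a act_before_subset_actions W(1)
      by (intro mult_left_mono expectation_diff_actions) auto
    ultimately have "q_val M \<alpha> V x (\<phi> x) < q_val M \<alpha> V x a"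
      using gap \<open>0 < \<alpha>\<close> by (smt (verit) zero_less_power mult_pos_pos)
    moreover have "a \<in> actions M x" using a act_before_subset_actions by blast
    then have "q_val M \<alpha> V x a \<le> q_val M \<alpha> V x (\<phi> x)" using gr by (simp add: greedy_def)
    ultimately show False by simp
  qed
qed

section \<open>The discounted value of a policy\<close>

lemma mat_pow_Suc_mult: "mat_pow Q (Suc t) *v v = Q *v (mat_pow Q t *v v)"
  by (simp add: matrix_vector_mul_assoc)

lemma mat_pow_bounded:
  assumes "\<phi> \<in> decision_rules M" "\<And>x. \<bar>v $ x\<bar> \<le> c"
  shows "\<bar>(mat_pow (P_mat M \<phi>) t *v v) $ x\<bar> \<le> c"
proof (induction t arbitrary: x)
  case 0
  then show ?case using assms(2) by simp
next
  case (Suc t)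
  have \<phi>: "\<phi> x \<in> actions M x" using assms(1) by (simp add: decision_rules_def)
  have "\<bar>(mat_pow (P_mat M \<phi>) (Suc t) *v v) $ x\<bar>
      \<le> (\<Sum>y\<in>UNIV. \<bar>trans_prob M x (\<phi> x) y * (mat_pow (P_mat M \<phi>) t *v v) $ y\<bar>)"
    unfolding mat_pow_Suc_mult P_mat_mult_nth by (rule sum_abs)
  also have "\<dots> \<le> (\<Sum>y\<in>UNIV. trans_prob M x (\<phi> x) y * c)"
    using Suc trans_prob_nonneg[OF \<phi>] by (intro sum_mono) (auto simp: abs_mult intro!: mult_mono)
  also have "\<dots> = c" using trans_prob_sum[OF \<phi>] by (simp flip: sum_distrib_right)
  finally show ?case .
qed

text \<open>Powers of a stochastic matrix do not enlarge the coordinates, so a geometric series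
  dominates; the factor \<open>CARD('x)\<close> comes from bounding the norm by the sum of the
  coordinates.\<close>

lemma summable_v_policy:
  assumes "0 \<le> \<alpha>" "\<alpha> < 1" "\<phi> \<in> decision_rules M"
  shows "summable (\<lambda>t. \<alpha> ^ t *\<^sub>R (mat_pow (P_mat M \<phi>) t *v r_vec M \<phi>))"
proof (rule summable_comparison_test)
  let ?c = "norm (r_vec M \<phi>)"
  have "norm (mat_pow (P_mat M \<phi>) t *v r_vec M \<phi>) \<le> (\<Sum>x\<in>(UNIV::'x set). ?c)" for t
    by (rule order_trans[OF norm_le_l1_cart sum_mono])
       (use mat_pow_bounded[OF assms(3)] component_le_norm_cart in blast)
  then have "norm (\<alpha> ^ t *\<^sub>R (mat_pow (P_mat M \<phi>) t *v r_vec M \<phi>)) \<le> \<alpha> ^ t * (real CARD('x) * ?c)" for t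
    using assms(1) by (auto intro!: mult_left_mono)
  then show "\<exists>N. \<forall>t\<ge>N. norm (\<alpha> ^ t *\<^sub>R (mat_pow (P_mat M \<phi>) t *v r_vec M \<phi>)) \<le> \<alpha> ^ t * (real CARD('x) * ?c)"
    by blast
  show "summable (\<lambda>t. \<alpha> ^ t * (real CARD('x) * ?c))"
    using assms by (intro summable_mult2 summable_geometric) auto
qed

text \<open>Applying \<alpha> P(\<phi>) shifts the series by one term, and the missing head is
  r(\<phi>).\<close>

lemma v_policy_fixed_point:
  assumes "0 \<le> \<alpha>" "\<alpha> < 1" "\<phi> \<in> decision_rules M"
  shows "T_op M \<alpha> \<phi> (v_policy M \<alpha> \<phi>) = v_policy M \<alpha> \<phi>"
proof -
  let ?f = "\<lambda>t. \<alpha> ^ t *\<^sub>R (mat_pow (P_mat M \<phi>) t *v r_vec M \<phi>)"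
  have bl: "bounded_linear (\<lambda>v. \<alpha> *\<^sub>R (P_mat M \<phi> *v v))"
    by (intro bounded_linear_scaleR_right[THEN bounded_linear_compose] matrix_vector_mul_bounded_linear)
  have "\<alpha> *\<^sub>R (P_mat M \<phi> *v suminf ?f) = (\<Sum>t. \<alpha> *\<^sub>R (P_mat M \<phi> *v ?f t))"
    by (rule bounded_linear.suminf[OF bl summable_v_policy[OF assms]])
  also have "(\<lambda>t. \<alpha> *\<^sub>R (P_mat M \<phi> *v ?f t)) = (\<lambda>t. ?f (Suc t))"
    unfolding mat_pow_Suc_mult by (simp add: matrix_vector_mult_scaleR)
  also have "(\<Sum>t. ?f (Suc t)) = suminf ?f - ?f 0"
    by (rule suminf_split_head[OF summable_v_policy[OF assms]])
  finally show ?thesis by (simp add: T_op_def v_policy_def)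
qed

text \<open>For a pair of states with the largest difference d, the fixed-point equation gives d
  \<le> 2 R* + \<alpha> d.\<close>

lemma v_policy_span:
  assumes "0 \<le> \<alpha>" "\<alpha> < 1" "\<phi> \<in> decision_rules M"
  shows "v_policy M \<alpha> \<phi> $ x - v_policy M \<alpha> \<phi> $ y \<le> 2 * R_star M / (1 - \<alpha>)"
proof -
  let ?v = "v_policy M \<alpha> \<phi>"
  let ?d = "\<lambda>(x, y). ?v $ x - ?v $ y"
  have "Max (range ?d) \<in> range ?d" by (intro Max_in) auto
  then obtain z where "Max (range ?d) = ?d z" by (rule imageE)
  then obtain x0 y0 where "Max (range ?d) = ?d (x0, y0)" by (cases z) simp
  moreover have "?d (x, y) \<le> Max (range ?d)" for x y by (intro Max_ge) auto
  ultimately have max: "?v $ x - ?v $ y \<le> ?v $ x0 - ?v $ y0" for x y by simp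
  have fixed: "?v $ z = q_val M \<alpha> ?v z (\<phi> z)" for z
    using v_policy_fixed_point[OF assms] T_op_nth by metis
  have "?v $ x0 - ?v $ y0 \<le> 2 * R_star M + \<alpha> * (?v $ x0 - ?v $ y0)"
    using q_val_diff_le[OF assms(1) _ _ max, where a = "\<phi> x0" and x = x0 and a' = "\<phi> y0" and x' = y0] assms(3)
    unfolding fixed[symmetric] by (auto simp: decision_rules_def)
  then have "(?v $ x0 - ?v $ y0) * (1 - \<alpha>) \<le> 2 * R_star M" by (simp add: algebra_simps)
  then have "?v $ x0 - ?v $ y0 \<le> 2 * R_star M / (1 - \<alpha>)" using assms(2) by (simp add: pos_le_divide_eq)
  with max[of x y] show ?thesis by simp
qed

text \<open>Minimum principle: where w = U - v is smallest, w \<ge> \<alpha> P(\<phi>) w \<ge>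
  \<alpha> w, and \<alpha> < 1 forces w \<ge> 0.\<close>

lemma v_policy_le_superharmonic:
  assumes "0 \<le> \<alpha>" "\<alpha> < 1" "\<phi> \<in> decision_rules M" "\<And>x. T_op M \<alpha> \<phi> U $ x \<le> U $ x"
  shows "v_policy M \<alpha> \<phi> $ x \<le> U $ x"
proof -
  let ?w = "\<lambda>x. U $ x - v_policy M \<alpha> \<phi> $ x"
  have "Min (range ?w) \<in> range ?w" by (intro Min_in) auto
  then obtain x0 where x0: "Min (range ?w) = ?w x0" by (rule imageE)
  have min: "?w x0 \<le> ?w y" for y unfolding x0[symmetric] by (intro Min_le) auto
  have \<phi>: "\<phi> x0 \<in> actions M x0" using assms(3) by (simp add: decision_rules_def)
  have "q_val M \<alpha> U x0 (\<phi> x0) \<le> U $ x0" using assms(4) by (simp add: T_op_nth)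
  moreover have "q_val M \<alpha> (v_policy M \<alpha> \<phi>) x0 (\<phi> x0) = v_policy M \<alpha> \<phi> $ x0"
    using v_policy_fixed_point[OF assms(1-3)] T_op_nth by metis
  ultimately have "\<alpha> * (\<Sum>y\<in>UNIV. trans_prob M x0 (\<phi> x0) y * ?w y) \<le> ?w x0"
    by (simp add: q_val_def algebra_simps sum_subtractf)
  moreover have "(\<Sum>y\<in>UNIV. trans_prob M x0 (\<phi> x0) y * ?w x0) \<le> (\<Sum>y\<in>UNIV. trans_prob M x0 (\<phi> x0) y * ?w y)"
    using min trans_prob_nonneg[OF \<phi>] by (intro sum_mono mult_left_mono) auto
  then have "\<alpha> * ?w x0 \<le> \<alpha> * (\<Sum>y\<in>UNIV. trans_prob M x0 (\<phi> x0) y * ?w y)"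
    using trans_prob_sum[OF \<phi>] assms(1) by (intro mult_left_mono) (auto simp flip: sum_distrib_right)
  ultimately have "0 \<le> (1 - \<alpha>) * ?w x0" by (simp add: algebra_simps)
  then have "0 \<le> ?w x0" using assms(2) by (simp add: zero_le_mult_iff)
  with min[of x] show ?thesis by simp
qed

lemma finite_decision_rules: "finite (decision_rules M)"
proof -
  have "decision_rules M = PiE UNIV (actions M)" by (auto simp: decision_rules_def)
  then show ?thesis using finite_actions by (simp add: finite_PiE)
qed

lemma V_inf_eqI:
  assumes "\<phi> \<in> decision_rules M" "\<And>\<psi> x. \<psi> \<in> decision_rules M \<Longrightarrow> v_policy M \<alpha> \<psi> $ x \<le> v_policy M \<alpha> \<phi> $ x"
  shows "V_inf M \<alpha> = v_policy M \<alpha> \<phi>"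
  unfolding V_inf_def vec_eq_iff
  using assms finite_decision_rules by (auto intro!: Max_eqI)

text \<open>If no rule improves the value in one step, that value is superharmonic for every rule
  and so dominates the value of each.\<close>

lemma greedy_self_optimal:
  assumes "0 \<le> \<alpha>" "\<alpha> < 1" "greedy M \<alpha> (v_policy M \<alpha> \<phi>) \<phi>"
  shows "V_inf M \<alpha> = v_policy M \<alpha> \<phi>"
proof (rule V_inf_eqI)
  show \<phi>: "\<phi> \<in> decision_rules M" using assms(3) by (simp add: greedy_def)
  fix \<psi> x assume \<psi>: "\<psi> \<in> decision_rules M"
  have "T_op M \<alpha> \<psi> (v_policy M \<alpha> \<phi>) $ y \<le> T_op M \<alpha> \<phi> (v_policy M \<alpha> \<phi>) $ y" for y
    using assms(3) \<psi> by (auto simp: greedy_def T_op_nth decision_rules_def)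
  then show "v_policy M \<alpha> \<psi> $ x \<le> v_policy M \<alpha> \<phi> $ x"
    using v_policy_fixed_point[OF assms(1,2) \<phi>] by (intro v_policy_le_superharmonic[OF assms(1,2) \<psi>]) simp
qed

section \<open>Optimal policies below the threshold\<close>

text \<open>Such a rule picks from A_t for every t, so each application of P(\<phi>) turns r_t into
  r_(t+1). All rules in F_L therefore have the same value.\<close>

lemma mat_pow_r_vec:
  assumes "\<phi> \<in> F_seq M (L_idx M)"
  shows "(mat_pow (P_mat M \<phi>) t *v r_vec M \<phi>) $ x = r_seq M t x"
proof (induction t arbitrary: x)
  case 0
  have "\<phi> x \<in> act_before M 1 x" using assms act_before_L_idx_subset F_seq_iff by blast
  from g_seq_eq_r_seq[OF this, of 0] show ?case by (simp add: r_vec_def)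
next
  case (Suc t)
  have "\<phi> x \<in> act_before M (Suc (Suc t)) x" using assms act_before_L_idx_subset F_seq_iff by blast
  from g_seq_eq_r_seq[OF this, of "Suc t"] show ?case
    unfolding mat_pow_Suc_mult P_mat_mult_nth Suc by simp
qed

lemma v_policy_F_seq_eq:
  assumes "\<phi> \<in> F_seq M (L_idx M)" "\<psi> \<in> F_seq M (L_idx M)"
  shows "v_policy M \<alpha> \<phi> = v_policy M \<alpha> \<psi>"
proof -
  have "mat_pow (P_mat M \<phi>) t *v r_vec M \<phi> = mat_pow (P_mat M \<psi>) t *v r_vec M \<psi>" for t
    using mat_pow_r_vec[OF assms(1)] mat_pow_r_vec[OF assms(2)] by (simp add: vec_eq_iff)
  then show ?thesis by (simp add: v_policy_def)
qed

text \<open>The value is its own image under \<open>T_op\<close>, so each use of the fixed-point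
  equation adds one term to the expansion.\<close>

lemma expands_v_policy:
  assumes "0 < \<alpha>" "\<alpha> < 1" "\<phi> \<in> F_seq M (L_idx M)"
  shows "expands M \<alpha> (2 * R_star M / (1 - \<alpha>)) k (v_policy M \<alpha> \<phi>)"
proof (induction k)
  have \<phi>: "\<phi> \<in> decision_rules M" using assms(3) by (simp add: F_seq_def)
  {
    case 0
    show ?case using assms v_policy_span[OF _ _ \<phi>] by (intro expands_0) auto
  next
    case (Suc k)
    have "\<phi> x \<in> act_before M (Suc k) x" for x using assms(3) act_before_L_idx_subset F_seq_iff by blast
    from expands_Suc[OF Suc this] show ?case using v_policy_fixed_point[OF _ _ \<phi>] assms by simp
  }
qed

lemma greedy_v_policy_in_F_seq:
  assumes "0 < \<alpha>" "\<alpha> < Delta M (L_idx M)" "\<phi> \<in> F_seq M (L_idx M)" "greedy M \<alpha> (v_policy M \<alpha> \<phi>) \<psi>"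
  shows "\<psi> \<in> F_seq M (L_idx M)"
proof -
  have "\<alpha> < 1" using assms(2) Delta_le_1[of "L_idx M"] by simp
  then have "\<psi> x \<in> act_before M (Suc (L_idx M)) x" for x
    using gap_of_less_Delta[OF assms(2)] expands_v_policy[OF assms(1) _ assms(3)]
    by (intro greedy_in_act_before[OF assms(1,4)]) auto
  then show ?thesis by (simp add: F_seq_iff)
qed

lemma D_inf_eq_F_seq:
  assumes "0 < \<alpha>" "\<alpha> < Delta M (L_idx M)"
  shows "D_inf M \<alpha> = F_seq M (L_idx M)"
proof -
  have \<alpha>: "0 \<le> \<alpha>" "\<alpha> < 1" using assms Delta_le_1[of "L_idx M"] by simp_all
  have F_sub: "F_seq M (L_idx M) \<subseteq> decision_rules M" by (auto simp: F_seq_def)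
  have opt: "V_inf M \<alpha> = v_policy M \<alpha> \<phi> \<and> greedy M \<alpha> (v_policy M \<alpha> \<phi>) \<phi>" if \<phi>: "\<phi> \<in> F_seq M (L_idx M)" for \<phi>
  proof -
    obtain \<psi> where \<psi>: "greedy M \<alpha> (v_policy M \<alpha> \<phi>) \<psi>" using greedy_exists by blast
    then have \<psi>F: "\<psi> \<in> F_seq M (L_idx M)" by (rule greedy_v_policy_in_F_seq[OF assms \<phi>])
    then have eq: "v_policy M \<alpha> \<psi> = v_policy M \<alpha> \<phi>" using \<phi> by (rule v_policy_F_seq_eq)
    \<comment> \<open>The rules \<phi> and \<psi> share one value, fixed by both operators; thus
      \<phi> inherits greediness from \<psi>.\<close>
    have "T_op M \<alpha> \<phi> (v_policy M \<alpha> \<phi>) = T_op M \<alpha> \<psi> (v_policy M \<alpha> \<phi>)"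
      using v_policy_fixed_point[OF \<alpha>] \<phi> \<psi>F F_sub eq by (metis subsetD)
    then have "greedy M \<alpha> (v_policy M \<alpha> \<phi>) \<phi>" using \<psi> \<phi> F_sub by (auto simp: greedy_iff)
    then show ?thesis using greedy_self_optimal[OF \<alpha>] by blast
  qed
  show ?thesis
  proof (intro equalityI subsetI)
    fix \<phi> assume "\<phi> \<in> F_seq M (L_idx M)"
    then show "\<phi> \<in> D_inf M \<alpha>" using opt F_sub by (auto simp: D_inf_def)
  next
    fix \<psi> assume \<psi>: "\<psi> \<in> D_inf M \<alpha>"
    obtain \<phi> where \<phi>: "\<phi> \<in> F_seq M (L_idx M)" using F_seq_nonempty by blast
    have dr: "\<psi> \<in> decision_rules M" "\<phi> \<in> decision_rules M" using \<psi> \<phi> F_sub by (auto simp: D_inf_def)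
    have eq: "v_policy M \<alpha> \<psi> = v_policy M \<alpha> \<phi>" using \<psi> opt[OF \<phi>] by (auto simp: D_inf_def)
    \<comment> \<open>An optimal \<psi> has the same value as \<phi>, so its fixed-point equation
      makes it greedy for that value.\<close>
    have "T_op M \<alpha> \<psi> (v_policy M \<alpha> \<phi>) = T_op M \<alpha> \<phi> (v_policy M \<alpha> \<phi>)"
      using v_policy_fixed_point[OF \<alpha> dr(1)] v_policy_fixed_point[OF \<alpha> dr(2)] eq by simp
    then have "greedy M \<alpha> (v_policy M \<alpha> \<phi>) \<psi>" using opt[OF \<phi>] dr by (simp add: greedy_iff)
    then show "\<psi> \<in> F_seq M (L_idx M)" by (rule greedy_v_policy_in_F_seq[OF assms \<phi>])
  qed
qed

section \<open>Finite-horizon iterates and the upper bound on the turnpike integer\<close>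

text \<open>A greedy rule for the previous iterate lies in F_(k-1) and so prolongs its expansion.
  Placing the rule there takes all shorter expansions, hence the strong induction; the gaps are
  controlled up to stage L, hence the cap on \<open>k\<close>.\<close>

lemma expands_V_fin:
  assumes "0 < \<alpha>" "\<alpha> < Delta M (L_idx M)" "k \<le> n" "k \<le> Suc (L_idx M)"
  shows "expands M \<alpha> (2 * R_star M / (1 - \<alpha>)) k (V_fin M \<alpha> n)"
  using assms(3,4)
proof (induction k arbitrary: n rule: less_induct)
  case (less k)
  have \<alpha>: "0 \<le> \<alpha>" "\<alpha> < 1" using assms Delta_le_1[of "L_idx M"] by simp_all
  show ?case
  proof (cases k)
    case 0
    then show ?thesis using V_fin_span[OF \<alpha>] by (auto intro: expands_0)
  next
    case (Suc j)
    with less.prems obtain n' where n: "n = Suc n'" "j \<le> n'" by (cases n) auto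
    obtain \<phi> where \<phi>: "greedy M \<alpha> (V_fin M \<alpha> n') \<phi>" using greedy_exists by blast
    have "\<phi> x \<in> act_before M (Suc j) x" for x
      using gap_of_less_Delta[OF assms(2)] less n Suc by (intro greedy_in_act_before[OF assms(1) \<phi>, where b = "2 * R_star M / (1 - \<alpha>)"]) auto
    then have "expands M \<alpha> (2 * R_star M / (1 - \<alpha>)) k (T_op M \<alpha> \<phi> (V_fin M \<alpha> n'))"
      unfolding Suc using less Suc n by (intro expands_Suc) auto
    moreover have "T_op M \<alpha> \<phi> (V_fin M \<alpha> n') = V_fin M \<alpha> n"
      using \<phi> n by (simp add: greedy_iff vec_eq_iff V_fin_Suc_nth)
    ultimately show ?thesis by simp
  qed
qed

text \<open>With k = L this yields the upper bound; smaller \<open>k\<close> locate the maximising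
  rules in the exact formula used for the lower bound.\<close>

lemma D_fin_subset_F_seq:
  assumes "0 < \<alpha>" "\<alpha> < Delta M (L_idx M)" "k < n" "k \<le> L_idx M"
  shows "D_fin M n \<alpha> \<subseteq> F_seq M k"
proof
  fix \<phi> assume "\<phi> \<in> D_fin M n \<alpha>"
  with assms(3) have gr: "greedy M \<alpha> (V_fin M \<alpha> (n - 1)) \<phi>" using D_fin_Suc_iff[of \<phi> "n - 1"] by simp
  have "\<phi> x \<in> act_before M (Suc k) x" for x
    using gap_of_less_Delta[OF assms(2)] expands_V_fin[OF assms(1,2)] assms(3,4)
    by (intro greedy_in_act_before[OF assms(1) gr, where b = "2 * R_star M / (1 - \<alpha>)"]) auto
  then show "\<phi> \<in> F_seq M k" by (simp add: F_seq_iff)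
qed

lemma D_fin_subset_D_inf:
  assumes "0 \<le> \<alpha>" "\<alpha> < Delta M (L_idx M)" "L_idx M < n"
  shows "D_fin M n \<alpha> \<subseteq> D_inf M \<alpha>"
proof (cases "\<alpha> = 0")
  case False
  then show ?thesis using D_fin_subset_F_seq[of \<alpha> "L_idx M" n] D_inf_eq_F_seq[of \<alpha>] assms by auto
next
  case True
  show ?thesis
  proof
    fix \<phi> assume "\<phi> \<in> D_fin M n \<alpha>"
    then have gr: "greedy M \<alpha> (V_fin M \<alpha> (n - 1)) \<phi>"
      using D_fin_Suc_iff[of \<phi> "n - 1"] assms(3) by simp
    \<comment> \<open>At \<alpha> = 0 the continuation value drops out of \<open>q_val\<close>, so
      greediness is the same for every vector.\<close>
    then have "greedy M \<alpha> (v_policy M \<alpha> \<phi>) \<phi>" using True by (simp add: greedy_def q_val_def)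
    then have "V_inf M \<alpha> = v_policy M \<alpha> \<phi>" using True by (intro greedy_self_optimal) auto
    with gr show "\<phi> \<in> D_inf M \<alpha>" by (simp add: D_inf_def greedy_def)
  qed
qed

lemma turnpike_le:
  assumes "0 \<le> \<alpha>" "\<alpha> < Delta M (L_idx M)"
  shows "turnpike M \<alpha> \<le> enat (L_idx M + 1)"
  unfolding turnpike_def using D_fin_subset_D_inf[OF assms] by (intro Inf_lower) auto

section \<open>The lower bound when the terminal terms do not depend on the rule\<close>

lemma V_fin_eq_of_singleton:
  assumes "0 < \<alpha>" "\<alpha> < Delta M (L_idx M)" "n \<le> L_idx M" "\<phi> \<in> F_seq M 0"
    and sing: "\<And>t \<phi> \<psi>. t \<le> L_idx M \<Longrightarrow> \<phi> \<in> F_seq M 0 \<Longrightarrow> \<psi> \<in> F_seq M 0 \<Longrightarrow>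
      mat_pow (P_mat M \<phi>) t *v s_vec M = mat_pow (P_mat M \<psi>) t *v s_vec M"
  shows "V_fin M \<alpha> n $ x =
    (\<Sum>j<n. \<alpha> ^ j * r_seq M j x) + \<alpha> ^ n * (mat_pow (P_mat M \<phi>) n *v s_vec M) $ x"
  using assms(3,4)
proof (induction n arbitrary: x \<phi>)
  case 0
  then show ?case by simp
next
  case (Suc n)
  obtain \<psi> where \<psi>: "greedy M \<alpha> (V_fin M \<alpha> n) \<psi>" using greedy_exists by blast
  then have "\<psi> \<in> F_seq M n" using D_fin_subset_F_seq[OF assms(1,2), of n "Suc n"] D_fin_Suc_iff Suc.prems by auto
  then have "\<psi> x \<in> act_before M (Suc n) x" and \<psi>0: "\<psi> \<in> F_seq M 0"
    using act_before_antimono[of "Suc 0" "Suc n"] by (auto simp: F_seq_iff)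
  have "V_fin M \<alpha> (Suc n) $ x = q_val M \<alpha> (V_fin M \<alpha> n) x (\<psi> x)"
    using \<psi> by (simp add: greedy_iff V_fin_Suc_nth T_op_nth)
  also have "\<dots> = (\<Sum>j<Suc n. \<alpha> ^ j * g_seq M j x (\<psi> x)) + \<alpha> ^ Suc n * (mat_pow (P_mat M \<psi>) (Suc n) *v s_vec M) $ x"
    unfolding mat_pow_Suc_mult P_mat_mult_nth
    \<comment> \<open>The induction hypothesis is taken at the greedy rule \<psi> itself, so that
      the remainder becomes a power of the single matrix P(\<psi>); \<open>sing\<close> then
      exchanges \<psi> for \<phi>.\<close>
    by (rule q_val_expansion) (use Suc.IH[OF _ \<psi>0] Suc.prems in simp)
  also have "mat_pow (P_mat M \<psi>) (Suc n) *v s_vec M = mat_pow (P_mat M \<phi>) (Suc n) *v s_vec M"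
    using sing Suc.prems \<psi>0 by blast
  finally show ?case using g_seq_eq_r_seq[OF \<open>\<psi> x \<in> act_before M (Suc n) x\<close>] by simp
qed

text \<open>A rule in F_(L-1) has g_j = r_j for all j < L, and its order-L term is the common
  terminal one, so it attains V_L: iteration L does not yet detect the last discarded
  actions.\<close>

lemma F_seq_subset_D_fin:
  assumes "0 < \<alpha>" "\<alpha> < Delta M (L_idx M)" "L_idx M = Suc l"
    and sing: "\<And>t \<phi> \<psi>. t \<le> L_idx M \<Longrightarrow> \<phi> \<in> F_seq M 0 \<Longrightarrow> \<psi> \<in> F_seq M 0 \<Longrightarrow>
      mat_pow (P_mat M \<phi>) t *v s_vec M = mat_pow (P_mat M \<psi>) t *v s_vec M"
  shows "F_seq M l \<subseteq> D_fin M (L_idx M) \<alpha>"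
proof
  fix \<phi> assume \<phi>: "\<phi> \<in> F_seq M l"
  then have 0: "\<phi> \<in> F_seq M 0" using act_before_antimono[of "Suc 0" "Suc l"] by (auto simp: F_seq_iff)
  note V = V_fin_eq_of_singleton[OF assms(1,2) _ 0 sing]
  have "V_fin M \<alpha> (Suc l) $ x = T_op M \<alpha> \<phi> (V_fin M \<alpha> l) $ x" for x
  proof -
    have "\<phi> x \<in> act_before M (Suc l) x" using \<phi> by (simp add: F_seq_iff)
    note g = g_seq_eq_r_seq[OF this]
    have "T_op M \<alpha> \<phi> (V_fin M \<alpha> l) $ x = (\<Sum>j<Suc l. \<alpha> ^ j * g_seq M j x (\<phi> x))
        + \<alpha> ^ Suc l * (mat_pow (P_mat M \<phi>) (Suc l) *v s_vec M) $ x"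
      unfolding mat_pow_Suc_mult P_mat_mult_nth T_op_nth
      by (rule q_val_expansion) (use V[of l] assms(3) in simp)
    then show ?thesis using V[of "Suc l"] assms(3) g by simp
  qed
  then show "\<phi> \<in> D_fin M (L_idx M) \<alpha>"
    using \<phi> assms(3) by (simp add: D_fin_def vec_eq_iff F_seq_def)
qed

lemma turnpike_ge:
  assumes "0 < \<alpha>" "\<alpha> < Delta M (L_idx M)"
    and sing: "\<And>t \<phi> \<psi>. t \<le> L_idx M \<Longrightarrow> \<phi> \<in> F_seq M 0 \<Longrightarrow> \<psi> \<in> F_seq M 0 \<Longrightarrow>
      mat_pow (P_mat M \<phi>) t *v s_vec M = mat_pow (P_mat M \<psi>) t *v s_vec M"
  shows "enat (L_idx M + 1) \<le> turnpike M \<alpha>"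
  unfolding turnpike_def
proof (rule Inf_greatest, clarify)
  fix N :: nat
  assume N: "1 \<le> N" "\<forall>n\<ge>N. D_fin M n \<alpha> \<subseteq> D_inf M \<alpha>"
  have "\<not> N \<le> L_idx M"
  proof
    assume le: "N \<le> L_idx M"
    \<comment> \<open>Since 1 \<le> N, the case L = 0 is impossible here and F_(L-1) is
      available.\<close>
    with N obtain l where l: "L_idx M = Suc l" by (cases "L_idx M") auto
    have "F_seq M l \<subseteq> F_seq M (L_idx M)"
      using F_seq_subset_D_fin[OF assms(1,2) l sing] N(2) le D_inf_eq_F_seq[OF assms(1,2)] by blast
    moreover have "F_seq M (L_idx M) \<subseteq> F_seq M l"
      using l act_before_antimono[of "Suc l" "Suc (Suc l)"] by (simp add: F_seq_iff subset_iff)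
    ultimately show False using F_seq_before_L_idx[OF l] by blast
  qed
  then show "enat (L_idx M + 1) \<le> enat N" by simp
qed

end

theorem theorem6p7:
  fixes M :: "('x::finite, 'a) mdp"
  assumes "finite_mdp M"
  shows "(turnpike_sup M {0..<Delta M (L_idx M)} \<le> enat (L_idx M + 1)
            \<and> L_idx M + 1 \<le> CARD('x))
       \<and> ((\<forall>t\<le>L_idx M. is_singleton ((\<lambda>\<phi>. mat_pow (P_mat M \<phi>) t *v s_vec M) ` F_seq M 0))
            \<longrightarrow> (\<forall>\<alpha>\<in>{0<..<Delta M (L_idx M)}. turnpike M \<alpha> = enat (L_idx M + 1)))"
proof -
  interpret finite_mdp M by fact
  have "turnpike_sup M {0..<Delta M (L_idx M)} \<le> enat (L_idx M + 1)"
    unfolding turnpike_sup_def by (rule SUP_least) (auto intro: turnpike_le[simplified])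
  moreover have "L_idx M + 1 \<le> CARD('x)" using L_idx_less_card by simp
  moreover have "turnpike M \<alpha> = enat (L_idx M + 1)"
    if sing: "\<forall>t\<le>L_idx M. is_singleton ((\<lambda>\<phi>. mat_pow (P_mat M \<phi>) t *v s_vec M) ` F_seq M 0)"
      and \<alpha>: "\<alpha> \<in> {0<..<Delta M (L_idx M)}" for \<alpha>
  proof (rule antisym)
    show "turnpike M \<alpha> \<le> enat (L_idx M + 1)" using \<alpha> by (intro turnpike_le) auto
    have "mat_pow (P_mat M \<phi>) t *v s_vec M = mat_pow (P_mat M \<psi>) t *v s_vec M"
      if "t \<le> L_idx M" "\<phi> \<in> F_seq M 0" "\<psi> \<in> F_seq M 0" for t \<phi> \<psi>
    proof -
      obtain v where v: "(\<lambda>\<phi>. mat_pow (P_mat M \<phi>) t *v s_vec M) ` F_seq M 0 = {v}"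
        using sing \<open>t \<le> L_idx M\<close> is_singletonE by meson
      have "mat_pow (P_mat M \<phi>) t *v s_vec M \<in> {v}" "mat_pow (P_mat M \<psi>) t *v s_vec M \<in> {v}"
        unfolding v[symmetric] using that by (auto intro: imageI)
      then show ?thesis by simp
    qed
    from turnpike_ge[OF _ _ this] show "enat (L_idx M + 1) \<le> turnpike M \<alpha>" using \<alpha> by simp
  qed
  ultimately show ?thesis by blast
qed

end
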